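(* Let $n\ge1$ and $L\ge1$. The characteristic polynomial of the de Bruijn process on $G^{n,L}$, that is, of the matrix ${}^\nabla\! M^{n,L}$, is $$\chi({}^\nabla\! M^{n,L};\lambda)=\lambda\,(\lambda+\beta_{1,1})^{n-1}\cdot\prod_{m=2}^{L}\ \prod_{a\in\Sigma}\left(\lambda+\beta_{a,m}\right)^{(n-1)n^{L-m}}.$$
   Context: Let $\Sigma=\{1,\dots,n\}$ and let $\Sigma^L$ be the set of words of length $L$ over $\Sigma$. Let $x_{a,k}$ ($a\in\Sigma$, $k\ge1$) be independent commuting formal variables. For a word $u=u_1\cdots u_L$ with $L\ge1$ put $h(u)=u_1\cdots u_{L-1}$ and $t(u)=u_2\cdots u_L$ (the empty word if $L=1$). For a nonempty word $u$, if the last block of $u$ (the maximal suffix of $u$ consisting of repetitions of a single letter) is $a^k$, put $\beta(u)=x_{a,k}$. The de Bruijn graph $G^{n,L}$ has vertex set $\Sigma^L$ and an edge from $u$ to $v$ if and only if $h(v)=t(u)$; the de Bruijn process is the continuous-time Markov chain in which the transition $u\to v$ along an edge has rate $\beta(v)$. The matrix $M^{n,L}$, indexed by $\Sigma^L\times\Sigma^L$, has entries $M^{n,L}_{v,u}=\beta(v)$ if $h(v)=t(u)$ and $0$ otherwise. For a square matrix $M$, ${}^\nabla\! M$ denotes the matrix obtained from $M$ by subtracting from each diagonal entry the sum of the entries of $M$ in its column. For $a\in\Sigma$, $m\ge1$ put $\beta_{a,m}=x_{a,m}+\sum_{b\in\Sigma,\,b\ne a}x_{b,1}$; in particular $\beta_{a,1}=\sum_{b\in\Sigma}x_{b,1}$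 does not depend on $a$. The characteristic polynomial of a square matrix $M$ is $\chi(M;\lambda)=\det(\lambda I-M)$. *)

theory Defs
  imports
    Jordan_Normal_Form.Char_Poly
    "HOL-Library.Poly_Mapping"
begin

(* Polynomials over 'r in variables indexed by pairs (a,k): a monomial is its finitely supported
   exponent vector, and a polynomial is a finitely supported map from monomials to coefficients. *)
type_synonym 'r mpol = "((nat \<times> nat) \<Rightarrow>\<^sub>0 nat) \<Rightarrow>\<^sub>0 'r"

definition xvar :: "nat \<Rightarrow> nat \<Rightarrow> 'r::comm_ring_1 mpol" where
  "xvar a k = Poly_Mapping.single (Poly_Mapping.single (a, k) 1) 1"

definition alphabet :: "nat \<Rightarrow> nat set" where
  "alphabet n = {1..n}"

definition words :: "nat \<Rightarrow> nat \<Rightarrow> nat list set" where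
  "words n L = {w. length w = L \<and> set w \<subseteq> alphabet n}"

definition last_block_length :: "nat list \<Rightarrow> nat" where
  "last_block_length u = length (takeWhile (\<lambda>b. b = last u) (rev u))"

definition beta :: "nat list \<Rightarrow> 'r::comm_ring_1 mpol" where
  "beta u = xvar (last u) (last_block_length u)"

definition de_bruijn_edges :: "nat \<Rightarrow> nat \<Rightarrow> (nat list \<times> nat list) set" where
  "de_bruijn_edges n L = {(u, v). u \<in> words n L \<and> v \<in> words n L \<and> butlast v = tl u}"

(* Row v, column u: the rate of the transition from u to v. *)
definition de_bruijn_entry :: "nat \<Rightarrow> nat \<Rightarrow> nat list \<Rightarrow> nat list \<Rightarrow> 'r::comm_ring_1 mpol" where
  "de_bruijn_entry n L v u = (if (u, v) \<in> de_bruijn_edges n L then beta v else 0)"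

(* Matrices have rows and columns numbered from 0, so the index set of words is listed as ws. *)
definition de_bruijn_mat :: "nat \<Rightarrow> nat \<Rightarrow> nat list list \<Rightarrow> 'r::comm_ring_1 mpol mat" where
  "de_bruijn_mat n L ws =
     mat (length ws) (length ws) (\<lambda>(i, j). de_bruijn_entry n L (ws ! i) (ws ! j))"

definition nabla :: "'a::comm_ring_1 mat \<Rightarrow> 'a mat" where
  "nabla M = mat (dim_row M) (dim_col M)
     (\<lambda>(i, j). M $$ (i, j) - (if i = j then \<Sum>k<dim_row M. M $$ (k, j) else 0))"

definition beta_sum :: "nat \<Rightarrow> nat \<Rightarrow> nat \<Rightarrow> 'r::comm_ring_1 mpol" where
  "beta_sum n a m = xvar a m + (\<Sum>b\<in>alphabet n - {a}. xvar b 1)"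

lemma ex_enumeration_words: "\<exists>ws. distinct ws \<and> set ws = words n L"
proof -
  have "words n L = {w. set w \<subseteq> alphabet n \<and> length w = L}"
    by (auto simp: words_def)
  then have "finite (words n L)"
    by (simp add: finite_lists_length_eq alphabet_def)
  then show ?thesis
    using finite_distinct_list by blast
qed

end

theory Submission
  imports Defs
begin

text \<open>Column \<open>u\<close> of the matrix depends on \<open>u\<close> only through \<open>tl u\<close>, apart from the diagonal entry, and
  the diagonal exit rate depends only on \<open>tl u\<close> as well. Hence the columns of words that differ
  only in their first letter can be subtracted from each other, and lumping these words splits off
  the factor \<open>(\<lambda> + exit rate)\<^sup>n\<^sup>-\<^sup>1\<close> for every word of length \<open>L - 1\<close>. What remains is the process on
  words of length \<open>L - 1\<close> with other rates at some loops, which do not affect the generator. The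
  theorem follows by induction on \<open>L\<close>, sorting the words of each length by their last block.\<close>

section \<open>Determinants indexed by lists\<close>

text \<open>Rows and columns are labelled by words instead of positions. The list only supplies an
  order; if it is distinct, the value does not depend on that order
  (\<open>det_on_reorder\<close>).\<close>

definition det_on :: "('b \<Rightarrow> 'b \<Rightarrow> 'a::comm_ring_1) \<Rightarrow> 'b list \<Rightarrow> 'a" where
  "det_on f ws = det (mat (length ws) (length ws) (\<lambda>(i, j). f (ws ! i) (ws ! j)))"

lemma det_on_cong:
  assumes "\<And>u v. u \<in> set ws \<Longrightarrow> v \<in> set ws \<Longrightarrow> f u v = g u v"
  shows "det_on f ws = det_on g ws"
  unfolding det_on_def by (intro arg_cong[where f = det] cong_mat) (auto simp: assms)

lemma det_on_transpose: "det_on (\<lambda>u v. f v u) ws = det_on f ws"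
proof -
  let ?A = "mat (length ws) (length ws) (\<lambda>(i, j). f (ws ! i) (ws ! j))"
  have "mat (length ws) (length ws) (\<lambda>(i, j). f (ws ! j) (ws ! i)) = transpose_mat ?A"
    by (rule eq_matI) auto
  then show ?thesis
    unfolding det_on_def using det_transpose[of ?A "length ws"] by simp
qed

text \<open>Rows and columns are permuted by the same \<open>p\<close>, so its sign enters twice and
  squares to 1.\<close>

lemma det_on_reorder:
  assumes "distinct ws" "distinct ws'" "set ws = set ws'"
  shows "det_on f ws' = det_on f ws"
proof -
  let ?n = "length ws"
  have "mset ws' = mset ws"
    using assms by (simp add: set_eq_iff_mset_eq_distinct)
  then obtain p where p: "p permutes {..<length ws}" "permute_list p ws = ws'"
    by (rule mset_eq_permutation)
  have p': "p permutes {0..<?n}"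
    using p(1) by (simp add: lessThan_atLeast0)
  have len: "length ws' = ?n"
    using p(2) by auto
  have nth: "ws' ! i = ws ! p i" if "i < ?n" for i
    using permute_list_nth[OF p(1) that] p(2) by simp
  have pl: "p i < ?n" if "i < ?n" for i
    using permutes_in_image[OF p(1), of i] that by auto
  define A where "A = mat ?n ?n (\<lambda>(i, j). f (ws ! i) (ws ! j))"
  define B where "B = mat ?n ?n (\<lambda>(i, j). A $$ (p i, j))"
  \<comment> \<open>Columns are permuted by transposing and permuting rows once more.\<close>
  define C where "C = mat ?n ?n (\<lambda>(i, j). transpose_mat B $$ (p i, j))"
  have car: "A \<in> carrier_mat ?n ?n" "B \<in> carrier_mat ?n ?n" "C \<in> carrier_mat ?n ?n"
    by (auto simp: A_def B_def C_def)
  have "mat (length ws') (length ws') (\<lambda>(i, j). f (ws' ! i) (ws' ! j)) = transpose_mat C"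
    by (rule eq_matI) (auto simp: A_def B_def C_def len nth pl)
  then have "det_on f ws' = det C"
    unfolding det_on_def using det_transpose[OF car(3)] by simp
  also have "\<dots> = signof p * det (transpose_mat B)"
    unfolding C_def by (rule det_permute_rows[OF _ p']) (use car in auto)
  also have "\<dots> = signof p * (signof p * det A)"
    using det_permute_rows[OF car(1) p'] det_transpose[OF car(2)] by (simp add: B_def)
  also have "\<dots> = det A"
    by (simp add: sign_def)
  finally show ?thesis
    by (simp add: det_on_def A_def)
qed

lemma det_on_add_row:
  assumes "distinct ws" "x \<in> set ws" "y \<in> set ws" "x \<noteq> y"
  shows "det_on (\<lambda>u v. if u = x then c * f y v + f u v else f u v) ws = det_on f ws"
proof -
  obtain k l where kl: "k < length ws" "l < length ws" "ws ! k = x" "ws ! l = y"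
    using assms(2,3) by (auto simp: in_set_conv_nth)
  let ?A = "mat (length ws) (length ws) (\<lambda>(i, j). f (ws ! i) (ws ! j))"
  have "mat (length ws) (length ws)
      (\<lambda>(i, j). if ws ! i = x then c * f y (ws ! j) + f (ws ! i) (ws ! j) else f (ws ! i) (ws ! j))
      = addrow c k l ?A"
    by (rule eq_matI) (use kl assms in \<open>auto simp: nth_eq_iff_index_eq\<close>)
  moreover have "det (addrow c k l ?A) = det ?A"
    by (rule det_addrow[of _ "length ws"]) (use kl assms in auto)
  ultimately show ?thesis
    by (simp add: det_on_def)
qed

lemma det_on_add_col:
  assumes "distinct ws" "x \<in> set ws" "y \<in> set ws" "x \<noteq> y"
  shows "det_on (\<lambda>u v. if v = x then c * f u y + f u v else f u v) ws = det_on f ws"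
  using det_on_add_row[OF assms, of c "\<lambda>u v. f v u"]
    det_on_transpose[of f ws]
    det_on_transpose[of "\<lambda>u v. if v = x then c * f u y + f u v else f u v" ws]
  by simp

text \<open>The matrix is block lower triangular with a last diagonal block of size 1.\<close>

lemma det_on_snoc_zero_col:
  assumes "\<And>u. u \<in> set zs \<Longrightarrow> f u y = 0"
  shows "det_on f (zs @ [y]) = det_on f zs * f y y"
proof -
  let ?n = "length zs"
  let ?A = "mat ?n ?n (\<lambda>(i, j). f (zs ! i) (zs ! j))"
  let ?D = "mat 1 1 (\<lambda>_. f y y)"
  have "mat (length (zs @ [y])) (length (zs @ [y])) (\<lambda>(i, j). f ((zs @ [y]) ! i) ((zs @ [y]) ! j))
    = four_block_mat ?A (0\<^sub>m ?n 1) (mat 1 ?n (\<lambda>(i, j). f y (zs ! j))) ?D"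
    by (rule eq_matI) (auto simp: nth_append assms less_Suc_eq)
  moreover have "det ?D = f y y"
    by (subst det_upper_triangular[of _ 1]) (auto simp: upper_triangular_def diag_mat_def)
  ultimately show ?thesis
    unfolding det_on_def
    using det_four_block_mat_upper_right_zero_col[of ?A ?n _ "mat 1 ?n (\<lambda>(i, j). f y (zs ! j))" ?D]
    by simp
qed

text \<open>Subtracting column \<open>q y\<close> from column \<open>y\<close> leaves only \<open>d y\<close> and \<open>- d y\<close> in rows
  \<open>y\<close> and \<open>q y\<close>; adding row \<open>y\<close> to row \<open>q y\<close> then clears the latter.\<close>

lemma det_on_lump:
  assumes "distinct (xs @ ys)" "q ` set ys \<subseteq> set xs"
    and "\<And>u y. u \<in> set (xs @ ys) \<Longrightarrow> y \<in> set ys \<Longrightarrow>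
      f u y = f u (q y) + (if u = y then d y else if u = q y then - d y else 0)"
  shows "det_on f (xs @ ys) =
    det_on (\<lambda>x x'. f x x' + (\<Sum>y | y \<in> set ys \<and> q y = x. f y x')) xs * (\<Prod>y\<in>set ys. d y)"
  using assms
\<comment> \<open>The matrix stays arbitrary, since eliminating one word alters it before the others
  are treated.\<close>
proof (induction ys arbitrary: f rule: rev_induct)
  case Nil
  then show ?case by simp
next
  case (snoc y ys)
  let ?ws = "xs @ ys @ [y]"
  have q: "q y \<in> set xs" "q y \<noteq> y" "q y \<in> set ?ws" "y \<in> set ?ws" "distinct ?ws"
    using snoc.prems by auto
  have y: "y \<notin> set xs" "y \<notin> set ys"
    using snoc.prems by auto
  define f1 where "f1 = (\<lambda>u v. if v = y then (- 1) * f u (q y) + f u v else f u v)"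
  define f2 where "f2 = (\<lambda>u v. if u = q y then 1 * f1 y v + f1 u v else f1 u v)"
  have f1y: "f1 u y = (if u = y then d y else if u = q y then - d y else 0)" if "u \<in> set ?ws" for u
    using snoc.prems(3)[of u y] that by (simp add: f1_def)
  have f2y: "f2 u y = (if u = y then d y else 0)" if "u \<in> set ?ws" for u
    using f1y[OF that] f1y[of y] q by (auto simp: f2_def)
  have f2: "f2 u v = f u v + (if u = q y then f y v else 0)" if "v \<noteq> y" for u v
    using that by (simp add: f2_def f1_def)
  have "det_on f ?ws = det_on f1 ?ws"
    unfolding f1_def using det_on_add_col[OF q(5,4,3), of "- 1" f] q by simp
  also have "\<dots> = det_on f2 ?ws"
    unfolding f2_def using det_on_add_row[OF q(5,3,4), of 1 f1] q by simp
  also have "\<dots> = det_on f2 (xs @ ys) * d y"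
  proof -
    have "f2 u y = 0" if "u \<in> set (xs @ ys)" for u
      using f2y[of u] that y by auto
    then show ?thesis
      using det_on_snoc_zero_col[of "xs @ ys" f2 y] f2y[of y] by simp
  qed
  also have "det_on f2 (xs @ ys) =
      det_on (\<lambda>x x'. f2 x x' + (\<Sum>z | z \<in> set ys \<and> q z = x. f2 z x')) xs * (\<Prod>z\<in>set ys. d z)"
  proof (rule snoc.IH)
    fix u z assume u: "u \<in> set (xs @ ys)" and z: "z \<in> set ys"
    have "z \<noteq> y" "q z \<in> set xs" "q z \<noteq> y" "z \<noteq> q y"
      using z y snoc.prems by auto
    \<comment> \<open>Row \<open>y\<close> has no correction term in column \<open>z\<close>, so
      adding it to row \<open>q y\<close> preserves the hypothesis for the remaining words.\<close>
    moreover have "f y z = f y (q z)"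
      using snoc.prems(3)[of y z] z calculation by auto
    ultimately show "f2 u z = f2 u (q z) + (if u = z then d z else if u = q z then - d z else 0)"
      using snoc.prems(3)[of u z] u z by (auto simp: f2)
  qed (use snoc.prems in auto)
  also have "det_on (\<lambda>x x'. f2 x x' + (\<Sum>z | z \<in> set ys \<and> q z = x. f2 z x')) xs =
      det_on (\<lambda>x x'. f x x' + (\<Sum>z | z \<in> set (ys @ [y]) \<and> q z = x. f z x')) xs"
  proof (rule det_on_cong)
    fix x x' assume x: "x \<in> set xs" "x' \<in> set xs"
    \<comment> \<open>Outside column \<open>y\<close> only row \<open>q y\<close> has changed, and
      \<open>q y\<close> lies in \<open>xs\<close>, so the rows summed here are the original
      ones.\<close>
    have "(\<Sum>z | z \<in> set ys \<and> q z = x. f2 z x') = (\<Sum>z | z \<in> set ys \<and> q z = x. f z x')"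
    proof (rule sum.cong)
      fix z assume "z \<in> {z. z \<in> set ys \<and> q z = x}"
      then have "z \<noteq> q y" "x' \<noteq> y"
        using x y q snoc.prems by auto
      then show "f2 z x' = f z x'"
        by (simp add: f2)
    qed simp
    moreover have "{z. z \<in> set (ys @ [y]) \<and> q z = x} =
        (if x = q y then insert y {z. z \<in> set ys \<and> q z = x} else {z. z \<in> set ys \<and> q z = x})"
      by auto
    moreover have "f2 x x' = f x x' + (if x = q y then f y x' else 0)"
      using x y by (intro f2) auto
    ultimately show "f2 x x' + (\<Sum>z | z \<in> set ys \<and> q z = x. f2 z x') =
        f x x' + (\<Sum>z | z \<in> set (ys @ [y]) \<and> q z = x. f z x')"
      using y by simp
  qed
  finally show ?case
    using y by (simp add: mult.assoc mult.commute)
qed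

section \<open>Words and their last blocks\<close>

lemma finite_alphabet [simp]: "finite (alphabet n)"
  by (simp add: alphabet_def)

lemma card_alphabet [simp]: "card (alphabet n) = n"
  by (simp add: alphabet_def)

lemma words_0: "words n 0 = {[]}"
  by (auto simp: words_def)

lemma words_Suc_Cons: "words n (Suc k) = (\<lambda>(a, w). a # w) ` (alphabet n \<times> words n k)"
  by (auto simp: words_def length_Suc_conv image_iff)

lemma words_Suc_snoc: "words n (Suc k) = (\<lambda>(w, b). w @ [b]) ` (words n k \<times> alphabet n)"
proof -
  have "w \<in> (\<lambda>(w, b). w @ [b]) ` (words n k \<times> alphabet n)" if "w \<in> words n (Suc k)" for w
    using that by (cases w rule: rev_cases) (auto simp: words_def image_iff)
  then show ?thesis
    by (auto simp: words_def)
qed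

lemma words_eq_lists: "words n k = {w. set w \<subseteq> alphabet n \<and> length w = k}"
  by (auto simp: words_def)

lemma finite_words [simp]: "finite (words n k)"
  by (simp add: words_eq_lists finite_lists_length_eq)

lemma card_words [simp]: "card (words n k) = n ^ k"
  by (simp add: words_eq_lists card_lists_length_eq)

lemma sum_words_Suc:
  "(\<Sum>v\<in>words n (Suc k). g v) = (\<Sum>w\<in>words n k. \<Sum>b\<in>alphabet n. g (w @ [b]))"
  unfolding words_Suc_snoc
  by (subst sum.reindex) (auto simp: inj_on_def sum.cartesian_product intro!: sum.cong)

lemma prod_words_Suc:
  "(\<Prod>v\<in>words n (Suc k). g v) = (\<Prod>w\<in>words n k. \<Prod>b\<in>alphabet n. g (w @ [b]))"
  unfolding words_Suc_snoc
  by (subst prod.reindex) (auto simp: inj_on_def prod.cartesian_product intro!: prod.cong)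

section \<open>Last blocks under adding a letter at either end\<close>

lemma last_block_length_snoc:
  "last_block_length (w @ [b]) = (if w \<noteq> [] \<and> b = last w then Suc (last_block_length w) else 1)"
  by (cases w rule: rev_cases) (auto simp: last_block_length_def)

lemma last_block_length_replicate:
  "last_block_length (replicate k a) = k"
proof (induction k)
  case (Suc k)
  have "replicate (Suc k) a = replicate k a @ [a]"
    by (simp add: replicate_append_same)
  with Suc show ?case
    by (cases k) (simp_all only: last_block_length_snoc last_replicate, auto)
qed (simp add: last_block_length_def)

text \<open>The maximal constant suffix can absorb a prepended letter only if the whole word already
  consists of that letter.\<close>

lemma last_block_length_Cons:
  assumes "w \<noteq> replicate (length w) a" "w \<noteq> []"
  shows "last_block_length (a # w) = last_block_length w"
  using assms
proof (induction w rule: rev_induct)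
  case (snoc b w)
  show ?case
  proof (cases "w = []")
    case True
    with snoc.prems show ?thesis
      using last_block_length_snoc[of "[a]" b] last_block_length_snoc[of "[]" b] by auto
  next
    case False
    show ?thesis
    proof (cases "w = replicate (length w) a")
      case True
      then have "last w = a"
        using False by (metis last_replicate length_0_conv)
      \<comment> \<open>Hence the last block is the single letter \<open>b\<close>, with or without
        the prepended \<open>a\<close>.\<close>
      moreover from this have "b \<noteq> a"
        using snoc.prems(1) True by (metis length_append_singleton replicate_Suc replicate_append_same)
      ultimately show ?thesis
        using False last_block_length_snoc[of "a # w" b] last_block_length_snoc[of w b] by simp
    next
      case False
      then show ?thesis
        using \<open>w \<noteq> []\<close> snoc.IH last_block_length_snoc[of "a # w" b] last_block_length_snoc[of w b]
        by simp
    qed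
  qed
qed simp

text \<open>Comparing letter by letter, each letter must equal its successor. So the loops of the
  graph sit exactly at the constant words.\<close>

lemma butlast_eq_tl_iff:
  "w \<noteq> [] \<Longrightarrow> butlast w = tl w \<longleftrightarrow> w = replicate (length w) (hd w)"
proof (induction w)
  case (Cons a w)
  show ?case
  proof (cases w)
    case (Cons b v)
    have "butlast (a # w) = tl (a # w) \<longleftrightarrow> a = b \<and> butlast w = tl w"
      by (simp add: Cons)
    also have "\<dots> \<longleftrightarrow> a = b \<and> w = replicate (length w) b"
      using Cons.IH Cons by simp
    finally show ?thesis
      by (auto simp: Cons)
  qed simp
qed simp

text \<open>A last block of \<open>m \<le> k\<close> letters \<open>a\<close> is preceded by one of
  \<open>n - 1\<close> other letters, and the \<open>k - m\<close> letters before that are free.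
  Block length \<open>Suc k\<close> leaves only the constant word.\<close>

lemma prod_words_last_block:
  fixes h :: "nat \<Rightarrow> nat \<Rightarrow> 'a::comm_semiring_1"
  shows "(\<Prod>w\<in>words n (Suc k). h (last w) (last_block_length w)) =
    (\<Prod>a\<in>alphabet n. h a (Suc k)) * (\<Prod>m=1..k. \<Prod>a\<in>alphabet n. h a m ^ ((n - 1) * n ^ (k - m)))"
proof (induction k arbitrary: h)
  case 0
  show ?case
    by (simp add: prod_words_Suc[of _ n 0] words_0 last_block_length_def)
next
  case (Suc k)
  \<comment> \<open>Repeating the last letter lengthens the block; every other letter starts a block
    of length 1.\<close>
  have *: "(\<Prod>b\<in>alphabet n. h b (last_block_length (w @ [b]))) =
      h (last w) (Suc (last_block_length w)) * (\<Prod>b\<in>alphabet n - {last w}. h b 1)"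
    if "w \<in> words n (Suc k)" for w
  proof -
    have "w \<noteq> []" "set w \<subseteq> alphabet n"
      using that by (auto simp: words_def)
    moreover from this have "last w \<in> alphabet n"
      using last_in_set by blast
    ultimately show ?thesis
      by (subst prod.remove[of _ "last w"])
        (auto simp: last_block_length_snoc intro!: arg_cong2[where f = times] prod.cong)
  qed
  have split: "(\<Prod>m=1..Suc k. g m) = g 1 * (\<Prod>m=2..Suc k. g m)" for g :: "nat \<Rightarrow> 'a"
    using prod.atLeast_Suc_atMost[of 1 "Suc k" g] by (simp only: numeral_2_eq_2) simp
  \<comment> \<open>Each letter \<open>b\<close> is left out for exactly one \<open>c\<close>, so it
    occurs \<open>n - 1\<close> times.\<close>
  have swap: "(\<Prod>c\<in>alphabet n. \<Prod>b\<in>alphabet n - {c}. h b 1) = (\<Prod>b\<in>alphabet n. h b 1) ^ (n - 1)"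
  proof -
    have "(\<Prod>c\<in>alphabet n. \<Prod>b\<in>alphabet n - {c}. h b 1) =
        (\<Prod>c\<in>alphabet n. \<Prod>b | b \<in> alphabet n \<and> b \<noteq> c. h b 1)"
      by (intro prod.cong) auto
    also have "\<dots> = (\<Prod>b\<in>alphabet n. \<Prod>c | c \<in> alphabet n \<and> b \<noteq> c. h b 1)"
      by (rule prod.swap_restrict) auto
    also have "\<dots> = (\<Prod>b\<in>alphabet n. h b 1 ^ (n - 1))"
    proof (rule prod.cong)
      fix b assume "b \<in> alphabet n"
      moreover have "{c. c \<in> alphabet n \<and> b \<noteq> c} = alphabet n - {b}"
        by auto
      ultimately show "(\<Prod>c | c \<in> alphabet n \<and> b \<noteq> c. h b 1) = h b 1 ^ (n - 1)"
        by simp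
    qed simp
    finally show ?thesis
      by (simp add: prod_power_distrib)
  qed
  \<comment> \<open>Each last letter is shared by \<open>n ^ k\<close> words.\<close>
  have "(\<Prod>w\<in>words n (Suc k). \<Prod>b\<in>alphabet n - {last w}. h b 1) =
      (\<Prod>b\<in>alphabet n. h b 1) ^ ((n - 1) * n ^ k)"
    by (simp add: prod_words_Suc[of _ n k] swap[simplified] power_mult)
  then have "(\<Prod>w\<in>words n (Suc (Suc k)). h (last w) (last_block_length w)) =
      (\<Prod>w\<in>words n (Suc k). h (last w) (Suc (last_block_length w))) *
      (\<Prod>b\<in>alphabet n. h b 1) ^ ((n - 1) * n ^ k)"
    by (simp add: prod_words_Suc[of _ n "Suc k"] * prod.distrib)
  \<comment> \<open>The induction hypothesis is applied to \<open>\<lambda>a m. h a (Suc m)\<close>,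
    which is why \<open>h\<close> is generalised.\<close>
  also have "(\<Prod>w\<in>words n (Suc k). h (last w) (Suc (last_block_length w))) =
      (\<Prod>a\<in>alphabet n. h a (Suc (Suc k))) *
      (\<Prod>m=1..k. \<Prod>a\<in>alphabet n. h a (Suc m) ^ ((n - 1) * n ^ (k - m)))"
    by (rule Suc.IH)
  also have "(\<Prod>m=1..k. \<Prod>a\<in>alphabet n. h a (Suc m) ^ ((n - 1) * n ^ (k - m))) =
      (\<Prod>m=2..Suc k. \<Prod>a\<in>alphabet n. h a m ^ ((n - 1) * n ^ (Suc k - m)))"
    using prod.shift_bounds_cl_Suc_ivl[of "\<lambda>m. \<Prod>a\<in>alphabet n. h a m ^ ((n - 1) * n ^ (Suc k - m))" 1 k]
    by (simp add: numeral_2_eq_2)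
  also have "(\<Prod>b\<in>alphabet n. h b 1) ^ ((n - 1) * n ^ k) =
      (\<Prod>a\<in>alphabet n. h a 1 ^ ((n - 1) * n ^ (Suc k - 1)))"
    by (simp add: prod_power_distrib)
  finally show ?case
    unfolding split by (simp only: mult_ac)
qed

section \<open>Lumping the de Bruijn process\<close>

lemma det_on_map: "det_on f (map g ws) = det_on (\<lambda>u v. f (g u) (g v)) ws"
  unfolding det_on_def by (intro arg_cong[where f = det] eq_matI) auto

lemma sum_const_poly: "(\<Sum>x\<in>A. [:f x:]) = [:\<Sum>x\<in>A. f x:]"
  by (induction A rule: infinite_finite_induct) auto

text \<open>Subtracting \<open>nabla M\<close> from \<lambda> I adds the column sums of
  \<open>M\<close> to the diagonal; \<open>[:s, 1:]\<close> is the polynomial \<lambda> + s.\<close>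

lemma char_poly_nabla:
  fixes e :: "'b \<Rightarrow> 'b \<Rightarrow> 'a::comm_ring_1"
  assumes "distinct ws"
  shows "char_poly (nabla (mat (length ws) (length ws) (\<lambda>(i, j). e (ws ! i) (ws ! j)))) =
    det_on (\<lambda>v u. (if v = u then [:\<Sum>w\<in>set ws. e w u, 1:] else 0) - [:e v u:]) ws"
proof -
  have "(\<Sum>k<length ws. e (ws ! k) u) = (\<Sum>w\<in>set ws. e w u)" for u
    using sum.reindex_bij_betw[OF bij_betw_nth[OF assms refl refl], of "\<lambda>w. e w u"] by simp
  then show ?thesis
    unfolding char_poly_def char_poly_matrix_def det_on_def nabla_def
    by (intro arg_cong[where f = det] eq_matI) (auto simp: nth_eq_iff_index_eq assms)
qed

text \<open>The total rate out of any word with tail \<open>w\<close>, loops included. For empty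
  \<open>w\<close> the letter 1 is an arbitrary representative, as \<open>beta_sum n a 1\<close> is
  the same for all letters \<open>a\<close>.\<close>

definition exit_rate :: "nat \<Rightarrow> nat list \<Rightarrow> 'r::comm_ring_1 mpol" where
  "exit_rate n w =
    (if w = [] then beta_sum n 1 1 else beta_sum n (last w) (Suc (last_block_length w)))"

lemma beta_sum_1: "a \<in> alphabet n \<Longrightarrow> beta_sum n a 1 = (\<Sum>b\<in>alphabet n. xvar b 1)"
  by (simp add: beta_sum_def sum.remove[of _ a])

text \<open>Appending the last letter again lengthens its block by one, and each other letter
  contributes \<open>xvar b 1\<close>; this is the shape of \<open>beta_sum\<close>.\<close>

lemma sum_beta_snoc:
  assumes "n \<ge> 1" "w \<in> words n k"
  shows "(\<Sum>b\<in>alphabet n. beta (w @ [b])) = exit_rate n w"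
proof (cases "w = []")
  case True
  have "1 \<in> alphabet n"
    using assms by (simp add: alphabet_def)
  with True show ?thesis
    by (simp add: exit_rate_def beta_def beta_sum_1[of 1, simplified] last_block_length_def)
next
  case False
  then have "last w \<in> alphabet n"
    using assms last_in_set[of w] by (auto simp: words_def)
  with False show ?thesis
    by (simp add: sum.remove[of _ "last w"] exit_rate_def beta_def last_block_length_snoc beta_sum_def)
qed

section \<open>Column sums and the characteristic matrix of the process\<close>

lemma de_bruijn_entry_words:
  assumes "u \<in> words n L" "v \<in> words n L"
  shows "de_bruijn_entry n L v u = (if butlast v = tl u then beta v else 0)"
  using assms by (simp add: de_bruijn_entry_def de_bruijn_edges_def)

lemma tl_words: "u \<in> words n (Suc k) \<Longrightarrow> tl u \<in> words n k"
  by (auto simp: words_Suc_Cons)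

text \<open>The successors of \<open>u\<close> are the words \<open>tl u @ [b]\<close>, so the
  column sum sees only \<open>tl u\<close>.\<close>

lemma sum_de_bruijn_entry:
  assumes "n \<ge> 1" "u \<in> words n (Suc k)"
  shows "(\<Sum>v\<in>words n (Suc k). de_bruijn_entry n (Suc k) v u) = exit_rate n (tl u)"
proof -
  have "(\<Sum>v\<in>words n (Suc k). de_bruijn_entry n (Suc k) v u) =
      (\<Sum>v\<in>words n (Suc k). if butlast v = tl u then beta v else 0)"
    using assms by (intro sum.cong) (auto simp: de_bruijn_entry_words)
  also have "\<dots> = (\<Sum>w\<in>words n k. if w = tl u then \<Sum>b\<in>alphabet n. beta (w @ [b]) else 0)"
    unfolding sum_words_Suc by (rule sum.cong) auto
  also have "\<dots> = (\<Sum>b\<in>alphabet n. beta (tl u @ [b]))"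
    using tl_words[OF assms(2)] by (simp add: sum.delta)
  also have "\<dots> = exit_rate n (tl u)"
    using assms(1) tl_words[OF assms(2)] by (rule sum_beta_snoc)
  finally show ?thesis .
qed

text \<open>The entry of the characteristic matrix in row \<open>v\<close> and column
  \<open>u\<close>. The word length is not a parameter, so one function serves all levels of the
  induction.\<close>

definition char_entry :: "nat \<Rightarrow> nat list \<Rightarrow> nat list \<Rightarrow> 'r::comm_ring_1 mpol poly" where
  "char_entry n v u =
    (if v = u then [:exit_rate n (tl u), 1:] else 0) - [:if butlast v = tl u then beta v else 0:]"

lemma char_poly_de_bruijn:
  assumes "n \<ge> 1" "distinct ws" "set ws = words n (Suc k)"
  shows "char_poly (nabla (de_bruijn_mat n (Suc k) ws :: 'r::comm_ring_1 mpol mat)) =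
    det_on (char_entry n) ws"
  unfolding de_bruijn_mat_def char_poly_nabla[OF assms(2)]
  by (rule det_on_cong)
    (simp only: assms(3) sum_de_bruijn_entry[OF assms(1)],
      simp add: de_bruijn_entry_words char_entry_def)

text \<open>Lumping alters only the rates of the loops at constant words, and these cancel in
  the diagonal of the generator.\<close>

lemma char_entry_lumped:
  assumes "w \<in> words n k" "w' \<in> words n k" "k \<ge> 1"
  shows "(if w' = w then [:exit_rate n w, 1:] else 0)
      - [:if butlast w' = tl w then beta (hd w # w') else 0:] =
    (char_entry n w' w :: 'r::comm_ring_1 mpol poly)"
proof -
  have ne: "w \<noteq> []" "w' \<noteq> []" and len: "length w = length w'"
    using assms by (auto simp: words_def)
  obtain a t where w: "w = a # t"
    using ne by (cases w) auto
  have a: "a \<in> alphabet n"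
    using assms(1) w by (auto simp: words_def)
  show ?thesis
  proof (cases "w' = w")
    case False
    \<comment> \<open>Prepending \<open>a\<close> could change the rate only for constant
      \<open>w'\<close>, but an edge from \<open>w\<close> would then force
      \<open>w = w'\<close>.\<close>
    have "w' \<noteq> replicate (length w') a" if "butlast w' = t"
    proof
      assume *: "w' = replicate (length w') a"
      have "t = butlast (replicate (length w') a)"
        using that * by simp
      also have "\<dots> = replicate (length t) a"
        using len w by (simp add: butlast_conv_take)
      finally have "w = replicate (length w') a"
        using len w by (simp flip: len)
      then show False
        using * False by simp
    qed
    then show ?thesis
      using False ne w by (auto simp: char_entry_def beta_def last_block_length_Cons)
  next
    case True
    show ?thesis
    proof (cases "w = replicate (length w) a")
      case const: True
      define j where "j = length t"
      have wj: "w = replicate (Suc j) a" and tj: "t = replicate j a"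
        using const unfolding w j_def by simp_all
      have aw: "a # w = replicate (Suc (Suc j)) a"
        using wj by simp
      have bt: "butlast w = tl w"
        using butlast_eq_tl_iff[OF ne(1)] const w by simp
      have lbl: "last_block_length w = Suc j" "last_block_length (a # w) = Suc (Suc j)"
          "last_block_length t = j"
        unfolding aw unfolding wj tj by (rule last_block_length_replicate)+
      have last: "last w = a" "t \<noteq> [] \<Longrightarrow> last t = a"
        unfolding wj tj by simp_all
      \<comment> \<open>Removing the loop rate leaves, on both sides, the sum of
        \<open>xvar b 1\<close> over the letters \<open>b\<close> other than
        \<open>a\<close>.\<close>
      have "exit_rate n w - beta (a # w) = (exit_rate n t - beta w :: 'r mpol)"
      proof (cases "t = []")
        case True
        have "1 \<in> alphabet n"
          using a by (auto simp: alphabet_def)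
        then have "beta_sum n 1 1 = (beta_sum n a 1 :: 'r mpol)"
          using beta_sum_1[of 1 n] beta_sum_1[OF a] by metis
        then show ?thesis
          using True lbl last tj ne by (simp add: exit_rate_def beta_def beta_sum_def)
      next
        case False
        then show ?thesis
          using lbl last ne by (simp add: exit_rate_def beta_def beta_sum_def)
      qed
      then show ?thesis
        using True bt w by (simp add: char_entry_def)
    next
      case nconst: False
      \<comment> \<open>There is no loop here, and the first letter of a nonconstant word does not
        affect its last block.\<close>
      have bt: "butlast w \<noteq> tl w"
        using butlast_eq_tl_iff[OF ne(1)] nconst w by simp
      have "t \<noteq> []" "t \<noteq> replicate (length t) a"
        using nconst w by auto
      then have "exit_rate n w = (exit_rate n t :: 'r mpol)"
        using w last_block_length_Cons[of t a] by (simp add: exit_rate_def)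
      then show ?thesis
        using True bt w by (simp add: char_entry_def)
    qed
  qed
qed

text \<open>These sums are the entries of the lumped matrix. For \<open>k \<ge> 1\<close> an edge
  from \<open>1 # w\<close> to \<open>a # w'\<close> forces \<open>a = hd w\<close>, so a single
  rate survives, and \<open>char_entry_lumped\<close> identifies the result.\<close>

lemma sum_char_entry_Cons:
  assumes "w \<in> words n k" "w' \<in> words n k" "1 \<in> alphabet n"
  shows "(\<Sum>a\<in>alphabet n. char_entry n (a # w') (1 # w)) =
    (if k = 0 then [:0, 1:] else char_entry n w' w :: 'r::comm_ring_1 mpol poly)"
proof -
  have eq: "(\<Sum>a\<in>alphabet n. char_entry n (a # w') (1 # w)) =
    (if w' = w then [:exit_rate n w, 1:] else 0)
      - [:\<Sum>a\<in>alphabet n. if butlast (a # w') = w then beta (a # w') else 0 :: 'r mpol:]"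
  proof -
    have "(\<Sum>a\<in>alphabet n. if a = 1 \<and> w' = w then [:exit_rate n w, 1:] else 0 :: 'r mpol poly) =
        (if w' = w then [:exit_rate n w, 1:] else 0)"
      using assms(3) by (cases "w' = w") (simp_all add: sum.delta)
    then show ?thesis
      by (simp add: char_entry_def sum_subtractf sum_const_poly cong: if_cong)
  qed
  show ?thesis
  proof (cases "k = 0")
    \<comment> \<open>All one-letter words merge into a single state whose total rate cancels the
      exit rate, leaving \<lambda>.\<close>
    case True
    then have "w = []" "w' = []"
      using assms by (auto simp: words_0)
    then show ?thesis
      using True assms(3) eq
      by (simp add: exit_rate_def beta_def last_block_length_def beta_sum_1[of 1, simplified])
  next
    case False
    then have ne: "w \<noteq> []" "w' \<noteq> []" and hd: "hd w \<in> alphabet n"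
      using assms hd_in_set[of w] by (auto simp: words_def)
    have "(\<Sum>a\<in>alphabet n. if butlast (a # w') = w then beta (a # w') else 0 :: 'r mpol) =
        (\<Sum>a\<in>alphabet n. if a = hd w then (if butlast w' = tl w then beta (hd w # w') else 0) else 0)"
      using ne by (intro sum.cong) (auto simp: neq_Nil_conv)
    also have "\<dots> = (if butlast w' = tl w then beta (hd w # w') else 0)"
      using hd by (simp add: sum.delta)
    finally show ?thesis
      using False eq char_entry_lumped[OF assms(1,2)] by simp
  qed
qed

text \<open>Words with equal tails are lumped, represented by first letter 1; each of the other
  \<open>n - 1\<close> words in a class splits off a factor. The case \<open>k = 0\<close> is
  separate because \<open>char_entry n [] []\<close> involves the meaningless rate
  \<open>beta []\<close>.\<close>

lemma det_on_char_entry_Suc: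
  assumes "n \<ge> 1" "distinct ws" "set ws = words n (Suc k)" "distinct vs" "set vs = words n k"
  shows "det_on (char_entry n :: _ \<Rightarrow> _ \<Rightarrow> 'r::comm_ring_1 mpol poly) ws =
    (if k = 0 then [:0, 1:] else det_on (char_entry n) vs)
      * (\<Prod>w\<in>words n k. [:exit_rate n w, 1:]) ^ (n - 1)"
proof -
  let ?F = "char_entry n :: _ \<Rightarrow> _ \<Rightarrow> 'r mpol poly"
  let ?d = "\<lambda>y. [:exit_rate n (tl y), 1:] :: 'r mpol poly"
  let ?q = "\<lambda>y :: nat list. 1 # tl y"
  have one: "1 \<in> alphabet n"
    using assms(1) by (simp add: alphabet_def)
  define xs where "xs = map (Cons 1) vs"
  have Y: "words n (Suc k) - set xs = (\<lambda>(a, w). a # w) ` ((alphabet n - {1}) \<times> words n k)"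
    unfolding words_Suc_Cons xs_def using assms by auto
  obtain ys where ys: "distinct ys" "set ys = words n (Suc k) - set xs"
    using finite_distinct_list[of "words n (Suc k) - set xs"] by auto
  have Y': "set ys = (\<lambda>(a, w). a # w) ` ((alphabet n - {1}) \<times> words n k)"
    using ys Y by simp
  have sub: "set xs \<subseteq> words n (Suc k)"
    unfolding words_Suc_Cons xs_def using assms one by auto
  have dist: "distinct (xs @ ys)"
    using ys assms by (auto simp: xs_def distinct_map)
  have all: "set (xs @ ys) = words n (Suc k)"
    using ys sub by auto
  have "det_on ?F ws = det_on ?F (xs @ ys)"
    using assms all by (intro det_on_reorder dist) auto
  also have "\<dots> = det_on (\<lambda>x x'. ?F x x' + (\<Sum>y | y \<in> set ys \<and> ?q y = x. ?F y x')) xs *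
      (\<Prod>y\<in>set ys. ?d y)"
  proof (rule det_on_lump[OF dist])
    show "?q ` set ys \<subseteq> set xs"
      by (auto simp: Y' xs_def assms(5))
    fix u y assume "u \<in> set (xs @ ys)" "y \<in> set ys"
    \<comment> \<open>Both columns have the same tail, hence equal rates and exit rates; they differ
      only in where the diagonal term stands.\<close>
    then have "y \<noteq> ?q y"
      by (auto simp: Y')
    then show "?F u y = ?F u (?q y) + (if u = y then ?d y else if u = ?q y then - ?d y else 0)"
      by (simp add: char_entry_def)
  qed
  also have "(\<Prod>y\<in>set ys. ?d y) = (\<Prod>(a, w)\<in>(alphabet n - {1}) \<times> words n k. [:exit_rate n w, 1:])"
    unfolding Y' by (subst prod.reindex) (auto simp: inj_on_def intro!: prod.cong)
  also have "\<dots> = (\<Prod>w\<in>words n k. [:exit_rate n w, 1:]) ^ (n - 1)"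
    using one by (simp flip: prod.cartesian_product)
  also have "det_on (\<lambda>x x'. ?F x x' + (\<Sum>y | y \<in> set ys \<and> ?q y = x. ?F y x')) xs =
      det_on (\<lambda>w' w. if k = 0 then [:0, 1:] else ?F w' w) vs"
    unfolding xs_def det_on_map
  proof (rule det_on_cong)
    fix w' w assume w: "w' \<in> set vs" "w \<in> set vs"
    have "{y. y \<in> set ys \<and> ?q y = 1 # w'} = (\<lambda>a. a # w') ` (alphabet n - {1})"
      using w assms(5) by (auto simp: Y')
    then have "(\<Sum>y | y \<in> set ys \<and> ?q y = 1 # w'. ?F y (1 # w)) =
        (\<Sum>a\<in>alphabet n - {1}. ?F (a # w') (1 # w))"
      by (simp add: sum.reindex inj_on_def)
    then have "?F (1 # w') (1 # w) + (\<Sum>y | y \<in> set ys \<and> ?q y = 1 # w'. ?F y (1 # w)) =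
        (\<Sum>a\<in>alphabet n. ?F (a # w') (1 # w))"
      using sum.remove[OF finite_alphabet one, of "\<lambda>a. ?F (a # w') (1 # w)"] by (simp only:)
    also have "\<dots> = (if k = 0 then [:0, 1:] else ?F w' w)"
      by (rule sum_char_entry_Cons) (use w assms(5) one in simp_all)
    finally show "?F (1 # w') (1 # w) + (\<Sum>y | y \<in> set ys \<and> ?q y = 1 # w'. ?F y (1 # w)) =
        (if k = 0 then [:0, 1:] else ?F w' w)" .
  qed
  also have "\<dots> = (if k = 0 then [:0, 1:] else det_on ?F vs)"
  proof (cases "k = 0")
    case True
    then have "set vs = {[]}"
      using assms by (simp add: words_0)
    with assms(4) have "vs = [[]]"
      by (cases vs) (auto simp: subset_singleton_iff)
    \<comment> \<open>The determinant of size 1 is split off the empty one, whose value is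
      1.\<close>
    moreover have "det_on (\<lambda>_ _. [:0, 1:] :: 'r mpol poly) [[]] = [:0, 1:]"
      using det_on_snoc_zero_col[of "[]" "\<lambda>_ _. [:0, 1:] :: 'r mpol poly" "[]"]
      by (simp add: det_on_def)
    ultimately show ?thesis
      using True by simp
  qed simp
  finally show ?thesis .
qed

text \<open>Each lumping contributes the product over words one letter shorter, to the power
  \<open>n - 1\<close>. Sorting these words by last block evaluates it, with block lengths raised by
  one as in \<open>exit_rate\<close>.\<close>

lemma det_on_char_entry:
  assumes "n \<ge> 1" "distinct ws" "set ws = words n (Suc k)"
  shows "det_on (char_entry n) ws =
    [:0, 1:] * [:beta_sum n 1 1, 1:] ^ (n - 1) *
    (\<Prod>m = 2..Suc k. \<Prod>a\<in>alphabet n.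
      [:beta_sum n a m, 1:] ^ ((n - 1) * n ^ (Suc k - m)) :: 'r::comm_ring_1 mpol poly)"
  using assms(2,3)
proof (induction k arbitrary: ws)
  case 0
  then show ?case
    using det_on_char_entry_Suc[OF assms(1) 0, of "[[]]"]
    by (simp add: words_0 exit_rate_def)
next
  case (Suc k)
  let ?B = "\<lambda>a m. [:beta_sum n a m, 1:] :: 'r mpol poly"
  obtain vs where vs: "distinct vs" "set vs = words n (Suc k)"
    using ex_enumeration_words by blast
  have "(\<Prod>w\<in>words n (Suc k). [:exit_rate n w, 1:] :: 'r mpol poly) =
      (\<Prod>w\<in>words n (Suc k). ?B (last w) (Suc (last_block_length w)))"
    by (rule prod.cong) (auto simp: exit_rate_def words_def)
  also have "\<dots> = (\<Prod>a\<in>alphabet n. ?B a (Suc (Suc k))) *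
      (\<Prod>m=1..k. \<Prod>a\<in>alphabet n. ?B a (Suc m) ^ ((n - 1) * n ^ (k - m)))"
    by (rule prod_words_last_block)
  also have "(\<Prod>m=1..k. \<Prod>a\<in>alphabet n. ?B a (Suc m) ^ ((n - 1) * n ^ (k - m))) =
      (\<Prod>m=2..Suc k. \<Prod>a\<in>alphabet n. ?B a m ^ ((n - 1) * n ^ (Suc k - m)))"
    using prod.shift_bounds_cl_Suc_ivl[of "\<lambda>m. \<Prod>a\<in>alphabet n. ?B a m ^ ((n - 1) * n ^ (Suc k - m))" 1 k]
    by (simp add: numeral_2_eq_2)
  finally have P: "(\<Prod>w\<in>words n (Suc k). [:exit_rate n w, 1:] :: 'r mpol poly) =
      (\<Prod>a\<in>alphabet n. ?B a (Suc (Suc k))) *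
      (\<Prod>m=2..Suc k. \<Prod>a\<in>alphabet n. ?B a m ^ ((n - 1) * n ^ (Suc k - m)))" .
  let ?X = "\<lambda>m. \<Prod>a\<in>alphabet n. ?B a m ^ ((n - 1) * n ^ (Suc k - m))"
  let ?R = "\<lambda>k. \<Prod>m=2..Suc k. \<Prod>a\<in>alphabet n. ?B a m ^ ((n - 1) * n ^ (Suc k - m))"
  \<comment> \<open>From \<open>n = 1 + (n - 1)\<close>: one share comes from the shorter process,
    \<open>n - 1\<close> shares from the factor split off.\<close>
  have exp: "(n - 1) * n ^ (Suc (Suc k) - m) =
      (n - 1) * n ^ (Suc k - m) + (n - 1) * n ^ (Suc k - m) * (n - 1)" if "m \<le> Suc k" for m
  proof -
    have "n ^ (Suc (Suc k) - m) = n ^ (Suc k - m) * (1 + (n - 1))"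
      using that assms(1) by (simp add: Suc_diff_le)
    then show ?thesis
      by (simp only: distrib_left mult.assoc mult_1_right)
  qed
  \<comment> \<open>The top index \<open>m = Suc (Suc k)\<close> is taken out; its exponent is
    \<open>n - 1\<close>.\<close>
  have "?R (Suc k) = (\<Prod>m=2..Suc k. \<Prod>a\<in>alphabet n. ?B a m ^ ((n - 1) * n ^ (Suc (Suc k) - m))) *
      (\<Prod>a\<in>alphabet n. ?B a (Suc (Suc k))) ^ (n - 1)"
    by (simp add: prod.atLeast_Suc_atMost_Suc_shift prod_power_distrib)
  also have "(\<Prod>m=2..Suc k. \<Prod>a\<in>alphabet n. ?B a m ^ ((n - 1) * n ^ (Suc (Suc k) - m))) =
      (\<Prod>m=2..Suc k. ?X m * ?X m ^ (n - 1))"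
  proof (rule prod.cong)
    fix m assume "m \<in> {2..Suc k}"
    then have m: "m \<le> Suc k"
      by simp
    show "(\<Prod>a\<in>alphabet n. ?B a m ^ ((n - 1) * n ^ (Suc (Suc k) - m))) = ?X m * ?X m ^ (n - 1)"
      unfolding exp[OF m] power_add prod.distrib prod_power_distrib power_mult[symmetric] ..
  qed simp
  also have "\<dots> = ?R k * ?R k ^ (n - 1)"
    unfolding prod.distrib prod_power_distrib ..
  finally have R: "?R (Suc k) = ?R k * ((\<Prod>a\<in>alphabet n. ?B a (Suc (Suc k))) * ?R k) ^ (n - 1)"
    by (simp add: power_mult_distrib mult_ac)
  have "det_on (char_entry n) ws = det_on (char_entry n) vs *
      ((\<Prod>a\<in>alphabet n. ?B a (Suc (Suc k))) * ?R k) ^ (n - 1)"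
    unfolding det_on_char_entry_Suc[OF assms(1) Suc.prems vs] P by simp
  also have "det_on (char_entry n) vs = [:0, 1:] * ?B 1 1 ^ (n - 1) * ?R k"
    by (rule Suc.IH[OF vs])
  finally show ?case
    unfolding R by (simp only: mult.assoc)
qed

theorem theorem12:
  fixes n L :: nat and ws :: "nat list list"
  assumes "n \<ge> 1" and "L \<ge> 1"
    and "distinct ws" and "set ws = words n L"
  shows "char_poly (nabla (de_bruijn_mat n L ws :: 'r::comm_ring_1 mpol mat)) =
    [:0, 1:] * [:beta_sum n 1 1, 1:] ^ (n - 1) *
    (\<Prod>m = 2..L. \<Prod>a\<in>alphabet n. [:beta_sum n a m, 1:] ^ ((n - 1) * n ^ (L - m)))"
proof -
  obtain k where L: "L = Suc k"
    using assms(2) by (cases L) auto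
  show ?thesis
    unfolding L char_poly_de_bruijn[OF assms(1,3) assms(4)[unfolded L]]
    by (rule det_on_char_entry[OF assms(1,3) assms(4)[unfolded L]])
qed

end
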